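(* Let $V=S\oplus S^\perp$ be a symplectic splitting and let $f:S\to S^\perp$ be a linear map with $\mathrm{Det}(f)\neq-1$. Let $T=\mathrm{graph}(f)=\{a+f(a):a\in S\}\subset V$ be the symplectic plane defined by $f$. Then $$\eta(\mu(S),\mu(T))=\frac{|1-\mathrm{Det}(f)|}{|1+\mathrm{Det}(f)|}.$$
   Context: Let $(V,\omega)$ be a $4$-dimensional real symplectic vector space; view $\omega$ also as a linear functional on $\Lambda^2 V$ via $\omega(u\wedge v)=\omega(u,v)$. Let $\mathrm{vol}\in\Lambda^4V$ be the element with $(\omega\wedge\omega)(\mathrm{vol})=-2$; equivalently $\mathrm{vol}=-u\wedge v\wedge u'\wedge v'$ whenever $\omega(u,v)=\omega(u',v')=1$ and all other products among $u,v,u',v'$ vanish. Let $\cdot$ be the symmetric bilinear form of signature $(3,3)$ on $\Lambda^2V$ given by $\alpha\wedge\beta=(\alpha\cdot\beta)\,\mathrm{vol}$. Let $W=\ker(\omega)\subset\Lambda^2V$, on which $\cdot$ has signature $(3,2)$. Let $\omega^*\in\Lambda^2V$ be defined by $\omega^*\cdot(u\wedge v)=\omega(u,v)$ for all $u,v\in V$; one has $\omega^*\cdot\omega^*=-2$ and $W=(\omega^* )^\perp$. The Plücker embedding is $\iota:\mathrm{Gr}(2,V)\to\mathbb P(\Lambda^2V)$, $\iota(\mathrm{span}(u,v))=[u\wedge v]$. A $2$-plane $S\subset V$ is nondegenerate (symplectic) if $\omega|_S$ is nondegenerate; then $S^\perp=\{v:\omega(v,S)=0\}$ is a nondegenerate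 $2$-plane and $V=S\oplus S^\perp$ is called a symplectic splitting. The map $\mu$ sends a $2$-plane $S$ to $\mu(S)=\left[\hat\sigma+\tfrac12\omega(\hat\sigma)\omega^*\right]\in\mathbb P(W)$, where $\hat\sigma\in\Lambda^2V$ is any nonzero representative of $\iota(S)$. For $S$ nondegenerate, $\mu(S)$ is a spacelike line (spanned by a vector of positive norm). For two spacelike lines $\ell_1,\ell_2$ in $W$ with unit representatives $s_i\in\ell_i$, $s_i\cdot s_i=1$, set $\eta(\ell_1,\ell_2)=|s_1\cdot s_2|$. For a linear map $f:S\to S^\perp$, $\mathrm{Det}(f)\in\mathbb R$ is defined by $\omega(f(a),f(b))=\mathrm{Det}(f)\,\omega(a,b)$ for all $a,b\in S$. The graph of $f$ is nondegenerate if and only if $\mathrm{Det}(f)\ne-1$. *)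

theory Defs
  imports "HOL-Analysis.Analysis" "HOL-Library.Poly_Mapping"
begin

section \<open>The exterior algebra of a real vector space\<close>

text \<open>
  The tensor algebra of \<^typ>\<open>'v\<close> is a quotient of the free associative algebra on the set
  \<^typ>\<open>'v\<close>, that is, of the monoid algebra of the free monoid of words over \<^typ>\<open>'v\<close>.  We
  divide by the linearity relations and by the relations \<open>v \<otimes> v = 0\<close> in one step.
\<close>

datatype 'v free_word = Word (letters: "'v list")

instantiation free_word :: (type) monoid_add
begin

definition zero_free_word :: "'a free_word" where
  "0 = Word []"

definition plus_free_word :: "'a free_word \<Rightarrow> 'a free_word \<Rightarrow> 'a free_word" where
  "v + w = Word (letters v @ letters w)"

instance
  by standard (simp_all add: zero_free_word_def plus_free_word_def)

end

instantiation poly_mapping :: (type, real_vector) real_vector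
begin

lift_definition scaleR_poly_mapping :: "real \<Rightarrow> ('a \<Rightarrow>\<^sub>0 'b) \<Rightarrow> 'a \<Rightarrow>\<^sub>0 'b"
  is "\<lambda>c f k. c *\<^sub>R f k"
proof -
  fix c :: real and f :: "'a \<Rightarrow> 'b"
  assume "finite {k. f k \<noteq> 0}"
  then show "finite {k. c *\<^sub>R f k \<noteq> 0}"
    by (rule rev_finite_subset) auto
qed

instance
  by standard (transfer, simp add: fun_eq_iff scaleR_add_right scaleR_add_left)+

end

type_synonym 'v free_algebra = "'v free_word \<Rightarrow>\<^sub>0 real"

definition gen :: "'v \<Rightarrow> 'v free_algebra" where
  "gen v = Poly_Mapping.single (Word [v]) 1"

definition exterior_relators :: "'v::real_vector free_algebra set" where
  "exterior_relators =
     {gen (u + v) - (gen u + gen v) | u v. True} \<union>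
     {gen (c *\<^sub>R v) - c *\<^sub>R gen v | c v. True} \<union>
     {gen v * gen v | v. True}"

definition exterior_ideal :: "'v::real_vector free_algebra set" where
  "exterior_ideal = span {p * r * q | p r q. r \<in> exterior_relators}"

lemma free_algebra_induct [case_names zero add]:
  fixes p :: "'v free_algebra"
  assumes "P 0" and "\<And>p k c. P p \<Longrightarrow> P (p + Poly_Mapping.single k c)"
  shows "P p"
proof (induction p rule: update_induct)
  case const
  show ?case by (fact assms(1))
next
  case (update f a b)
  have "Poly_Mapping.lookup f a = 0"
    using update.hyps(1) by (simp add: in_keys_iff)
  then have "Poly_Mapping.update a b f = f + Poly_Mapping.single a b"
    by (intro poly_mapping_eqI) (auto simp: lookup_update lookup_add lookup_single when_def)
  with assms(2)[OF update.IH] show ?case by simp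
qed

lemma free_algebra_scaleR_single:
  "c *\<^sub>R (Poly_Mapping.single k d :: 'v free_algebra) = Poly_Mapping.single k (c * d)"
  by (intro poly_mapping_eqI) (simp add: scaleR_poly_mapping.rep_eq lookup_single when_def)

lemma free_algebra_scaleR_conv:
  fixes p :: "'v free_algebra"
  shows "c *\<^sub>R p = Poly_Mapping.single 0 c * p" "c *\<^sub>R p = p * Poly_Mapping.single 0 c"
proof -
  show "c *\<^sub>R p = Poly_Mapping.single 0 c * p"
    by (induction p rule: free_algebra_induct)
      (simp_all add: distrib_left scaleR_add_right free_algebra_scaleR_single mult_single)
  show "c *\<^sub>R p = p * Poly_Mapping.single 0 c"
    by (induction p rule: free_algebra_induct)
      (simp_all add: distrib_right scaleR_add_right free_algebra_scaleR_single mult_single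
        mult.commute)
qed

lemma free_algebra_scaleR_mult:
  fixes p q :: "'v free_algebra"
  shows "(c *\<^sub>R p) * q = c *\<^sub>R (p * q)" "p * (c *\<^sub>R q) = c *\<^sub>R (p * q)"
proof -
  show "(c *\<^sub>R p) * q = c *\<^sub>R (p * q)"
    by (simp add: free_algebra_scaleR_conv(1) mult.assoc)
  show "p * (c *\<^sub>R q) = c *\<^sub>R (p * q)"
    by (simp add: free_algebra_scaleR_conv(2) mult.assoc)
qed

lemma exterior_ideal_mult:
  assumes "p \<in> exterior_ideal"
  shows "a * p * b \<in> exterior_ideal"
proof -
  let ?G = "{p * r * q | p r q. r \<in> (exterior_relators :: 'a free_algebra set)}"
  have "p \<in> span ?G"
    using assms by (simp add: exterior_ideal_def)
  then have "a * p * b \<in> span ?G"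
  proof (induction rule: span_induct_alt)
    case base
    then show ?case by (simp add: span_zero)
  next
    case (step c x y)
    then obtain p r q where x: "x = p * r * q" and r: "r \<in> exterior_relators"
      by blast
    have "a * x * b = (a * p) * r * (q * b)"
      by (simp add: x mult.assoc)
    with r have "a * x * b \<in> span ?G"
      by (blast intro: span_base)
    moreover have "a * (c *\<^sub>R x + y) * b = c *\<^sub>R (a * x * b) + a * y * b"
      by (simp add: distrib_left distrib_right free_algebra_scaleR_mult)
    ultimately show ?case
      using step by (simp add: span_add span_scale)
  qed
  then show ?thesis
    by (simp add: exterior_ideal_def)
qed

lemma subspace_exterior_ideal: "subspace exterior_ideal"
  by (simp add: exterior_ideal_def)

text \<open>No relator has a constant term, so the quotient is not the zero ring.\<close>

lemma one_notin_exterior_ideal: "1 \<notin> (exterior_ideal :: 'v::real_vector free_algebra set)"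
proof -
  let ?e = "\<lambda>p :: 'v free_algebra. Poly_Mapping.lookup p 0"
  have e_single: "?e (Poly_Mapping.single k c * Poly_Mapping.single k' c') =
      ?e (Poly_Mapping.single k c) * ?e (Poly_Mapping.single k' c')" for k k' c c'
  proof -
    have "k + k' = 0 \<longleftrightarrow> k = 0 \<and> k' = 0"
      by (cases k; cases k') (simp add: zero_free_word_def plus_free_word_def)
    then show ?thesis
      by (auto simp: mult_single lookup_single when_def)
  qed
  have e_single': "?e (p * Poly_Mapping.single k' c') = ?e p * ?e (Poly_Mapping.single k' c')"
    for p k' c'
    by (induction p rule: free_algebra_induct) (simp_all add: distrib_right lookup_add e_single)
  have e_mult: "?e (p * q) = ?e p * ?e q" for p q
    by (induction q rule: free_algebra_induct) (simp_all add: distrib_left lookup_add e_single')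
  have e_gen: "?e (gen v) = 0" for v
    by (simp add: gen_def lookup_single zero_free_word_def)
  have e_rel: "?e r = 0" if "r \<in> exterior_relators" for r
    using that by (auto simp: exterior_relators_def e_mult e_gen lookup_add lookup_minus
        scaleR_poly_mapping.rep_eq)
  have "?e p = 0" if "p \<in> exterior_ideal" for p
    using that unfolding exterior_ideal_def
  proof (induction rule: span_induct_alt)
    case base
    then show ?case by simp
  next
    case (step c x y)
    then show ?case
      by (auto simp: e_mult e_rel lookup_add scaleR_poly_mapping.rep_eq)
  qed
  moreover have "?e 1 = 1"
    by (simp add: lookup_one)
  ultimately show ?thesis
    by fastforce
qed

definition exterior_rel :: "'v::real_vector free_algebra \<Rightarrow> 'v free_algebra \<Rightarrow> bool" where
  "exterior_rel p q \<longleftrightarrow> p - q \<in> exterior_ideal"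

quotient_type (overloaded) 'v exterior = "'v::real_vector free_algebra" / exterior_rel
proof (rule equivpI)
  show "reflp (exterior_rel :: 'v free_algebra \<Rightarrow> _)"
    by (simp add: reflp_def exterior_rel_def subspace_0 subspace_exterior_ideal)
  show "symp (exterior_rel :: 'v free_algebra \<Rightarrow> _)"
    unfolding symp_def exterior_rel_def
    using subspace_neg[OF subspace_exterior_ideal] by fastforce
  show "transp (exterior_rel :: 'v free_algebra \<Rightarrow> _)"
    unfolding transp_def exterior_rel_def
    using subspace_add[OF subspace_exterior_ideal] by fastforce
qed

lemma exterior_rel_eqI: "p = q \<Longrightarrow> exterior_rel p q"
  by (simp add: exterior_rel_def subspace_0 subspace_exterior_ideal)

instantiation exterior :: (real_vector) real_algebra_1
begin

lift_definition zero_exterior :: "'a exterior" is 0 .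

lift_definition one_exterior :: "'a exterior" is 1 .

lift_definition plus_exterior :: "'a exterior \<Rightarrow> 'a exterior \<Rightarrow> 'a exterior" is "(+)"
  unfolding exterior_rel_def
  by (simp add: add_diff_add subspace_add[OF subspace_exterior_ideal])

lift_definition uminus_exterior :: "'a exterior \<Rightarrow> 'a exterior" is uminus
  unfolding exterior_rel_def
  using subspace_neg[OF subspace_exterior_ideal] by fastforce

lift_definition minus_exterior :: "'a exterior \<Rightarrow> 'a exterior \<Rightarrow> 'a exterior" is "(-)"
proof -
  fix p p' q q' :: "'a free_algebra"
  assume "exterior_rel p p'" "exterior_rel q q'"
  then have "(p - p') - (q - q') \<in> exterior_ideal"
    unfolding exterior_rel_def by (rule subspace_diff[OF subspace_exterior_ideal])
  then show "exterior_rel (p - q) (p' - q')"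
    unfolding exterior_rel_def by (simp add: algebra_simps)
qed

lift_definition scaleR_exterior :: "real \<Rightarrow> 'a exterior \<Rightarrow> 'a exterior" is "(*\<^sub>R)"
  unfolding exterior_rel_def
  by (simp add: subspace_scale[OF subspace_exterior_ideal] flip: scaleR_diff_right)

lift_definition times_exterior :: "'a exterior \<Rightarrow> 'a exterior \<Rightarrow> 'a exterior" is "(*)"
proof -
  fix p p' q q' :: "'a free_algebra"
  assume "exterior_rel p p'" "exterior_rel q q'"
  then have "1 * (p - p') * q + p' * (q - q') * 1 \<in> exterior_ideal"
    unfolding exterior_rel_def
    by (intro subspace_add subspace_exterior_ideal exterior_ideal_mult)
  then show "exterior_rel (p * q) (p' * q')"
    unfolding exterior_rel_def by (simp add: algebra_simps)
qed

instance
proof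
  show "(0 :: 'a exterior) \<noteq> 1"
  proof (transfer, unfold exterior_rel_def)
    show "0 - 1 \<notin> (exterior_ideal :: 'a free_algebra set)"
      using one_notin_exterior_ideal[where 'v = 'a] subspace_neg[OF subspace_exterior_ideal]
      by fastforce
  qed
  fix x y z :: "'a exterior" and c d :: real
  show "x + y + z = x + (y + z)" by (transfer, simp add: exterior_rel_eqI add.assoc)
  show "x + y = y + x" by (transfer, simp add: exterior_rel_eqI add.commute)
  show "0 + x = x" by (transfer, simp add: exterior_rel_eqI)
  show "- x + x = 0" by (transfer, simp add: exterior_rel_eqI)
  show "x - y = x + - y" by (transfer, simp add: exterior_rel_eqI)
  show "c *\<^sub>R (x + y) = c *\<^sub>R x + c *\<^sub>R y"
    by (transfer, simp add: exterior_rel_eqI scaleR_add_right)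
  show "(c + d) *\<^sub>R x = c *\<^sub>R x + d *\<^sub>R x"
    by (transfer, simp add: exterior_rel_eqI scaleR_add_left)
  show "c *\<^sub>R d *\<^sub>R x = (c * d) *\<^sub>R x" by (transfer, simp add: exterior_rel_eqI)
  show "1 *\<^sub>R x = x" by (transfer, simp add: exterior_rel_eqI)
  show "x * y * z = x * (y * z)" by (transfer, simp add: exterior_rel_eqI mult.assoc)
  show "(x + y) * z = x * z + y * z" by (transfer, simp add: exterior_rel_eqI distrib_right)
  show "x * (y + z) = x * y + x * z" by (transfer, simp add: exterior_rel_eqI distrib_left)
  show "c *\<^sub>R x * y = c *\<^sub>R (x * y)"
    by (transfer, simp add: exterior_rel_eqI free_algebra_scaleR_mult)
  show "x * c *\<^sub>R y = c *\<^sub>R (x * y)"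
    by (transfer, simp add: exterior_rel_eqI free_algebra_scaleR_mult)
  show "1 * x = x" by (transfer, simp add: exterior_rel_eqI)
  show "x * 1 = x" by (transfer, simp add: exterior_rel_eqI)
qed

end

lift_definition ext_vec :: "'v::real_vector \<Rightarrow> 'v exterior" is gen .

definition wedge :: "'v::real_vector \<Rightarrow> 'v \<Rightarrow> 'v exterior" where
  "wedge u v = ext_vec u * ext_vec v"

definition ext_power :: "nat \<Rightarrow> 'v::real_vector exterior set" where
  "ext_power k = span {prod_list (map ext_vec vs) | vs. length vs = k}"


section \<open>Symplectic forms and the induced form on bivectors\<close>

definition symplectic_form :: "('v::real_vector \<Rightarrow> 'v \<Rightarrow> real) \<Rightarrow> bool" where
  "symplectic_form \<omega> \<longleftrightarrow>
     bilinear \<omega> \<and> (\<forall>v. \<omega> v v = 0) \<and> (\<forall>u. (\<forall>v. \<omega> u v = 0) \<longrightarrow> u = 0)"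

text \<open>
  The linear functional on bivectors (resp. 4-vectors) with prescribed values on decomposable ones.
  The functional \<open>L\<close> is determined only on \<open>ext_power 2\<close> (resp. \<open>ext_power 4\<close>), so the value is
  meaningful for \<open>\<alpha>\<close> in that subspace.
\<close>

definition functional2 :: "('v::real_vector \<Rightarrow> 'v \<Rightarrow> real) \<Rightarrow> 'v exterior \<Rightarrow> real" where
  "functional2 \<phi> \<alpha> =
     (THE c. \<exists>L. linear L \<and> (\<forall>u v. L (wedge u v) = \<phi> u v) \<and> c = L \<alpha>)"

definition functional4 ::
  "('v::real_vector \<Rightarrow> 'v \<Rightarrow> 'v \<Rightarrow> 'v \<Rightarrow> real) \<Rightarrow> 'v exterior \<Rightarrow> real" where
  "functional4 \<psi> \<alpha> =
     (THE c. \<exists>L. linear L \<and>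
        (\<forall>u v w x. L (ext_vec u * ext_vec v * ext_vec w * ext_vec x) = \<psi> u v w x) \<and> c = L \<alpha>)"

text \<open>
  The wedge product of alternating 2-forms, as a signed sum over the (2,2)-shuffles.  With this
  normalisation \<open>(\<omega> \<and> \<omega>)(u \<and> v \<and> u' \<and> v') = 2\<close> when \<open>\<omega> u v = \<omega> u' v' = 1\<close> and
  the other products of \<open>u, v, u', v'\<close> vanish, so that \<open>vol = - u \<and> v \<and> u' \<and> v'\<close> below.
\<close>

definition wedge_form ::
  "('v \<Rightarrow> 'v \<Rightarrow> real) \<Rightarrow> ('v \<Rightarrow> 'v \<Rightarrow> real) \<Rightarrow> 'v \<Rightarrow> 'v \<Rightarrow> 'v \<Rightarrow> 'v \<Rightarrow> real" where
  "wedge_form \<phi> \<psi> a b c d =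
       \<phi> a b * \<psi> c d - \<phi> a c * \<psi> b d + \<phi> a d * \<psi> b c
     + \<phi> b c * \<psi> a d - \<phi> b d * \<psi> a c + \<phi> c d * \<psi> a b"

definition vol :: "('v::real_vector \<Rightarrow> 'v \<Rightarrow> real) \<Rightarrow> 'v exterior" where
  "vol \<omega> = (THE \<tau>. \<tau> \<in> ext_power 4 \<and> functional4 (wedge_form \<omega> \<omega>) \<tau> = -2)"

definition bivec_dot ::
  "('v::real_vector \<Rightarrow> 'v \<Rightarrow> real) \<Rightarrow> 'v exterior \<Rightarrow> 'v exterior \<Rightarrow> real" where
  "bivec_dot \<omega> \<alpha> \<beta> = (THE c. \<alpha> * \<beta> = c *\<^sub>R vol \<omega>)"

definition omega_star :: "('v::real_vector \<Rightarrow> 'v \<Rightarrow> real) \<Rightarrow> 'v exterior" where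
  "omega_star \<omega> =
     (THE \<alpha>. \<alpha> \<in> ext_power 2 \<and> (\<forall>u v. bivec_dot \<omega> \<alpha> (wedge u v) = \<omega> u v))"


section \<open>Planes, the map to the projectivised kernel, and the invariants\<close>

definition plane :: "'v::real_vector set \<Rightarrow> bool" where
  "plane S \<longleftrightarrow> subspace S \<and> dim S = 2"

text \<open>
  A point of a projective space is represented by the line (one-dimensional subspace) itself.
  The line representing \<open>mu \<omega> S\<close> lies in \<open>W\<close>, the kernel of \<open>functional2 \<omega>\<close> in \<open>ext_power 2\<close>.
  In \<open>eta\<close>, existence of the unit vectors expresses that the two lines are spacelike.
\<close>

definition pluecker :: "'v::real_vector set \<Rightarrow> 'v exterior set" where
  "pluecker S =
     (THE l. \<exists>u v. u \<noteq> v \<and> independent {u, v} \<and> S = span {u, v} \<and> l = span {wedge u v})"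

definition mu :: "('v::real_vector \<Rightarrow> 'v \<Rightarrow> real) \<Rightarrow> 'v set \<Rightarrow> 'v exterior set" where
  "mu \<omega> S =
     (THE l. \<exists>\<sigma>. \<sigma> \<in> pluecker S \<and> \<sigma> \<noteq> 0 \<and>
        l = span {\<sigma> + (1 / 2 * functional2 \<omega> \<sigma>) *\<^sub>R omega_star \<omega>})"

definition eta ::
  "('v::real_vector \<Rightarrow> 'v \<Rightarrow> real) \<Rightarrow> 'v exterior set \<Rightarrow> 'v exterior set \<Rightarrow> real" where
  "eta \<omega> l\<^sub>1 l\<^sub>2 =
     (THE r. \<exists>s\<^sub>1 s\<^sub>2. s\<^sub>1 \<in> l\<^sub>1 \<and> s\<^sub>2 \<in> l\<^sub>2 \<and>
        bivec_dot \<omega> s\<^sub>1 s\<^sub>1 = 1 \<and> bivec_dot \<omega> s\<^sub>2 s\<^sub>2 = 1 \<and> r = \<bar>bivec_dot \<omega> s\<^sub>1 s\<^sub>2\<bar>)"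

definition nondegenerate_plane :: "('v::real_vector \<Rightarrow> 'v \<Rightarrow> real) \<Rightarrow> 'v set \<Rightarrow> bool" where
  "nondegenerate_plane \<omega> S \<longleftrightarrow>
     plane S \<and> (\<forall>a\<in>S. (\<forall>b\<in>S. \<omega> a b = 0) \<longrightarrow> a = 0)"

definition symp_perp :: "('v \<Rightarrow> 'v \<Rightarrow> real) \<Rightarrow> 'v set \<Rightarrow> 'v set" where
  "symp_perp \<omega> S = {v. \<forall>s\<in>S. \<omega> v s = 0}"

definition linear_between :: "'v::real_vector set \<Rightarrow> 'v set \<Rightarrow> ('v \<Rightarrow> 'v) \<Rightarrow> bool" where
  "linear_between S S' f \<longleftrightarrow>
     (\<forall>a\<in>S. f a \<in> S') \<and> (\<forall>a\<in>S. \<forall>b\<in>S. f (a + b) = f a + f b) \<and>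
     (\<forall>c. \<forall>a\<in>S. f (c *\<^sub>R a) = c *\<^sub>R f a)"

definition symp_Det :: "('v \<Rightarrow> 'v \<Rightarrow> real) \<Rightarrow> 'v set \<Rightarrow> ('v \<Rightarrow> 'v) \<Rightarrow> real" where
  "symp_Det \<omega> S f = (THE d. \<forall>a\<in>S. \<forall>b\<in>S. \<omega> (f a) (f b) = d * \<omega> a b)"

definition graph_plane :: "'v::plus set \<Rightarrow> ('v \<Rightarrow> 'v) \<Rightarrow> 'v set" where
  "graph_plane S f = {a + f a | a. a \<in> S}"

end

theory Submission
  imports Defs
begin

text \<open>
  Complete a basis \<open>e\<^sub>1, e\<^sub>2\<close> of \<open>S\<close> with \<open>\<omega> e\<^sub>1 e\<^sub>2 = 1\<close> to a symplectic basis of the whole space.  The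
  universal property of the exterior algebra provides the functionals induced by \<open>\<omega>\<close> and
  \<open>\<omega> \<and> \<omega>\<close>; the latter shows that \<open>e\<^sub>1 \<and> e\<^sub>2 \<and> e\<^sub>3 \<and> e\<^sub>4\<close> is nonzero, so it is \<open>- vol\<close>, and
  \<open>\<omega>\<^sup>* = - e\<^sub>1 \<and> e\<^sub>2 - e\<^sub>3 \<and> e\<^sub>4\<close>.  With \<open>D = Det f\<close> and the representatives
  \<open>\<alpha> = \<sigma> + \<omega>(\<sigma>)/2 \<omega>\<^sup>*\<close> for \<open>S\<close> and \<open>\<beta>\<close> for \<open>T\<close> one gets \<open>\<alpha> \<cdot> \<alpha> = 1/2\<close>,
  \<open>\<beta> \<cdot> \<beta> = (1 + D)\<^sup>2/2\<close> and \<open>\<alpha> \<cdot> \<beta> = (1 - D)/2\<close>.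
\<close>

section \<open>The universal property of the exterior algebra\<close>

text \<open>One function on words encodes a family of alternating forms, one for each degree.
  Vanishing is asked for adjacent repetitions because the relator \<open>gen v * gen v\<close> puts
  equal letters side by side.\<close>

definition alternating_on_lists :: "('v::real_vector list \<Rightarrow> real) \<Rightarrow> bool" where
  "alternating_on_lists \<phi> \<longleftrightarrow>
     (\<forall>xs ys u v. \<phi> (xs @ (u + v) # ys) = \<phi> (xs @ u # ys) + \<phi> (xs @ v # ys)) \<and>
     (\<forall>xs ys c v. \<phi> (xs @ (c *\<^sub>R v) # ys) = c * \<phi> (xs @ v # ys)) \<and>
     (\<forall>xs ys v. \<phi> (xs @ v # v # ys) = 0)"

definition free_lift :: "('v list \<Rightarrow> real) \<Rightarrow> 'v free_algebra \<Rightarrow> real" where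
  "free_lift \<phi> p = (\<Sum>w\<in>Poly_Mapping.keys p. Poly_Mapping.lookup p w * \<phi> (letters w))"

text \<open>Zero coefficients contribute nothing, so \<open>p\<close>, \<open>q\<close> and
  \<open>p + q\<close> can be summed over one common index set when linearity is proved.\<close>

lemma free_lift_superset:
  assumes "finite A" "Poly_Mapping.keys p \<subseteq> A"
  shows "free_lift \<phi> p = (\<Sum>w\<in>A. Poly_Mapping.lookup p w * \<phi> (letters w))"
  unfolding free_lift_def
  by (rule sum.mono_neutral_left) (use assms in \<open>auto simp: in_keys_iff\<close>)

lemma linear_free_lift: "linear (free_lift \<phi>)"
proof (rule linearI)
  fix p q :: "'a free_algebra" and c :: real
  let ?A = "Poly_Mapping.keys p \<union> Poly_Mapping.keys q"
  have "free_lift \<phi> r = (\<Sum>w\<in>?A. Poly_Mapping.lookup r w * \<phi> (letters w))"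
    if "r \<in> {p, q, p + q}" for r
    using that Poly_Mapping.keys_add[of p q] by (intro free_lift_superset) auto
  then show "free_lift \<phi> (p + q) = free_lift \<phi> p + free_lift \<phi> q"
    by (simp add: lookup_add distrib_right sum.distrib)
  have "free_lift \<phi> (c *\<^sub>R p) =
      (\<Sum>w\<in>Poly_Mapping.keys p. Poly_Mapping.lookup (c *\<^sub>R p) w * \<phi> (letters w))"
    by (intro free_lift_superset) (auto simp: in_keys_iff scaleR_poly_mapping.rep_eq)
  then show "free_lift \<phi> (c *\<^sub>R p) = c *\<^sub>R free_lift \<phi> p"
    by (simp add: free_lift_def scaleR_poly_mapping.rep_eq sum_distrib_left mult.assoc)
qed

lemma free_lift_single: "free_lift \<phi> (Poly_Mapping.single w c) = c * \<phi> (letters w)"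
  by (subst free_lift_superset[of "{w}"]) auto

text \<open>By linearity in \<open>p\<close> and \<open>q\<close>, single words on both sides
  suffice. They become \<open>xs\<close> and \<open>ys\<close> in a clause of
  \<open>alternating_on_lists\<close>, one clause for each kind of relator.\<close>

lemma free_lift_relator:
  assumes "alternating_on_lists \<phi>" "r \<in> exterior_relators"
  shows "free_lift \<phi> (p * r * q) = 0"
proof (induction p rule: free_algebra_induct)
  case zero
  show ?case by (simp add: linear_0[OF linear_free_lift])
next
  case (add p k c)
  have "free_lift \<phi> (Poly_Mapping.single k c * r * q) = 0"
  proof (induction q rule: free_algebra_induct)
    case zero
    show ?case by (simp add: linear_0[OF linear_free_lift])
  next
    case (add q k' c')
    from assms(2) consider
        u v where "r = gen (u + v) - (gen u + gen v)"
      | a v where "r = gen (a *\<^sub>R v) - a *\<^sub>R gen v"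
      | v where "r = gen v * gen v"
      unfolding exterior_relators_def by blast
    then have "free_lift \<phi> (Poly_Mapping.single k c * r * Poly_Mapping.single k' c') = 0"
      by cases (use assms(1) in
        \<open>simp_all add: alternating_on_lists_def gen_def mult_single
          plus_free_word_def free_lift_single free_algebra_scaleR_single
          distrib_left distrib_right left_diff_distrib right_diff_distrib mult_ac
          linear_add[OF linear_free_lift] linear_diff[OF linear_free_lift]\<close>)
    with add.IH add show ?case
      by (simp add: distrib_left linear_add[OF linear_free_lift])
  qed
  with add show ?case
    by (simp add: distrib_right linear_add[OF linear_free_lift])
qed

lemma free_lift_exterior_ideal:
  assumes "alternating_on_lists \<phi>" "p \<in> exterior_ideal"
  shows "free_lift \<phi> p = 0"
  using assms(2) unfolding exterior_ideal_def
proof (induction rule: span_induct_alt)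
  case base
  show ?case by (simp add: linear_0[OF linear_free_lift])
next
  case (step c x y)
  then show ?case
    by (auto simp: linear_add[OF linear_free_lift] linear_scale[OF linear_free_lift]
        free_lift_relator[OF assms(1)])
qed

lemma prod_list_ext_vec:
  "prod_list (map ext_vec vs) = abs_exterior (Poly_Mapping.single (Word vs) 1)"
proof (induction vs)
  case Nil
  show ?case by (simp add: one_exterior_def flip: zero_free_word_def)
next
  case (Cons v vs)
  have "gen v * Poly_Mapping.single (Word vs) 1 = Poly_Mapping.single (Word (v # vs)) 1"
    by (simp add: gen_def mult_single plus_free_word_def)
  then show ?case
    by (simp only: list.map prod_list.Cons Cons) (simp only: ext_vec.abs_eq times_exterior.abs_eq)
qed

text \<open>\<open>free_lift \<phi>\<close> vanishes on \<open>exterior_ideal\<close>, so its value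
  at \<open>rep_exterior x\<close> does not depend on the representative.\<close>

lemma exterior_lift_ex:
  assumes "alternating_on_lists \<phi>"
  shows "\<exists>L. linear L \<and> (\<forall>vs. L (prod_list (map ext_vec vs)) = \<phi> vs)"
proof -
  define L where "L x = free_lift \<phi> (rep_exterior x)" for x
  have L_abs: "L (abs_exterior p) = free_lift \<phi> p" for p
  proof -
    have "exterior_rel p (rep_exterior (abs_exterior p))"
      by (metis Quotient3_abs_rep Quotient3_exterior exterior.abs_eq_iff)
    then have "free_lift \<phi> (p - rep_exterior (abs_exterior p)) = 0"
      unfolding exterior_rel_def by (rule free_lift_exterior_ideal[OF assms])
    then show ?thesis
      by (simp add: L_def linear_diff[OF linear_free_lift])
  qed
  have "linear L"
  proof (rule linearI)
    fix x y :: "'a exterior" and c :: real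
    obtain p q where "x = abs_exterior p" "y = abs_exterior q"
      by (metis Quotient3_abs_rep Quotient3_exterior)
    then show "L (x + y) = L x + L y" "L (c *\<^sub>R x) = c *\<^sub>R L x"
      by (simp_all add: plus_exterior.abs_eq scaleR_exterior.abs_eq L_abs
          linear_add[OF linear_free_lift] linear_scale[OF linear_free_lift])
  qed
  moreover have "L (prod_list (map ext_vec vs)) = \<phi> vs" for vs
    by (simp add: prod_list_ext_vec L_abs free_lift_single)
  ultimately show ?thesis by blast
qed

text \<open>Linear functionals that agree on wedges agree on their span \<open>ext_power 2\<close>,
  so exhibiting one of them settles the definite description.\<close>

lemma functional2_eqI:
  assumes "linear L" "\<And>u v. L (wedge u v) = \<phi> u v" "\<alpha> \<in> ext_power 2"
  shows "functional2 \<phi> \<alpha> = L \<alpha>"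
  unfolding functional2_def
proof (rule the_equality)
  show "\<exists>K. linear K \<and> (\<forall>u v. K (wedge u v) = \<phi> u v) \<and> L \<alpha> = K \<alpha>"
    using assms by blast
next
  fix c
  assume "\<exists>K. linear K \<and> (\<forall>u v. K (wedge u v) = \<phi> u v) \<and> c = K \<alpha>"
  then obtain K where K: "linear K" "\<And>u v. K (wedge u v) = \<phi> u v" "c = K \<alpha>"
    by blast
  have "K \<alpha> = L \<alpha>"
    by (rule linear_eq_on[OF K(1) assms(1) assms(3)[unfolded ext_power_def]])
      (auto simp: K(2) assms(2) numeral_2_eq_2 length_Suc_conv simp flip: wedge_def)
  with K(3) show "c = L \<alpha>" by simp
qed

lemma functional4_eqI:
  assumes "linear L"
    "\<And>u v w x. L (ext_vec u * ext_vec v * ext_vec w * ext_vec x) = \<psi> u v w x"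
    "\<alpha> \<in> ext_power 4"
  shows "functional4 \<psi> \<alpha> = L \<alpha>"
  unfolding functional4_def
proof (rule the_equality)
  show "\<exists>K. linear K \<and> (\<forall>u v w x. K (ext_vec u * ext_vec v * ext_vec w * ext_vec x) = \<psi> u v w x)
      \<and> L \<alpha> = K \<alpha>"
    using assms by blast
next
  fix c
  assume "\<exists>K. linear K \<and>
      (\<forall>u v w x. K (ext_vec u * ext_vec v * ext_vec w * ext_vec x) = \<psi> u v w x) \<and> c = K \<alpha>"
  then obtain K where K: "linear K"
      "\<And>u v w x. K (ext_vec u * ext_vec v * ext_vec w * ext_vec x) = \<psi> u v w x" "c = K \<alpha>"
    by blast
  have "K \<alpha> = L \<alpha>"
    by (rule linear_eq_on[OF K(1) assms(1) assms(3)[unfolded ext_power_def]])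
      (auto simp: K(2) assms(2) eval_nat_numeral length_Suc_conv simp flip: mult.assoc)
  with K(3) show "c = L \<alpha>" by simp
qed

section \<open>Relations among products of vectors\<close>

lemma exterior_relators_subset_ideal: "exterior_relators \<subseteq> exterior_ideal"
proof
  fix r :: "'v::real_vector free_algebra"
  assume "r \<in> exterior_relators"
  then have "1 * r * 1 \<in> {p * r * q | p r q. r \<in> exterior_relators}"
    by blast
  then show "r \<in> exterior_ideal"
    by (simp add: exterior_ideal_def span_base)
qed

lemma ext_vec_add: "ext_vec (u + v) = ext_vec u + ext_vec v"
  by (transfer, unfold exterior_rel_def, rule subsetD[OF exterior_relators_subset_ideal])
    (auto simp: exterior_relators_def)

lemma ext_vec_scaleR: "ext_vec (c *\<^sub>R v) = c *\<^sub>R ext_vec v"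
  by (transfer, unfold exterior_rel_def, rule subsetD[OF exterior_relators_subset_ideal])
    (auto simp: exterior_relators_def)

lemma ext_vec_square: "ext_vec v * ext_vec v = 0"
  by (transfer, unfold exterior_rel_def, rule subsetD[OF exterior_relators_subset_ideal])
    (auto simp: exterior_relators_def)

lemma ext_vec_anticomm: "ext_vec u * ext_vec v = - (ext_vec v * ext_vec u)"
proof -
  have "ext_vec (u + v) * ext_vec (u + v) = ext_vec u * ext_vec v + ext_vec v * ext_vec u"
    unfolding ext_vec_add by (simp add: algebra_simps ext_vec_square)
  then show ?thesis
    by (simp add: ext_vec_square eq_neg_iff_add_eq_0)
qed

text \<open>Anticommutation brings the two copies of \<open>x\<close> together, where their product
  is zero.\<close>

lemma wedge_mult_common:
  "wedge x y * wedge x z = 0" "wedge x y * wedge z x = 0"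
  "wedge y x * wedge x z = 0" "wedge y x * wedge z x = 0"
proof -
  have sandwich: "ext_vec x * ext_vec y * ext_vec x = 0" for x y :: 'a
    by (subst ext_vec_anticomm) (simp add: mult.assoc ext_vec_square)
  show 1: "wedge x y * wedge x z = 0"
    using arg_cong[OF sandwich[of x y], of "\<lambda>t. t * ext_vec z"] by (simp add: wedge_def mult.assoc)
  have "wedge z x = - wedge x z" "wedge y x = - wedge x y"
    unfolding wedge_def by (rule ext_vec_anticomm)+
  with 1 show "wedge x y * wedge z x = 0" "wedge y x * wedge x z = 0" "wedge y x * wedge z x = 0"
    by simp_all
qed

section \<open>Alternating forms as functionals on the exterior algebra\<close>

lemma alternating_imp_antisym:
  fixes \<phi> :: "'v::real_vector \<Rightarrow> 'v \<Rightarrow> real"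
  assumes "bilinear \<phi>" "\<And>v. \<phi> v v = 0"
  shows "\<phi> u v = - \<phi> v u"
proof -
  have "\<phi> (u + v) (u + v) = \<phi> u v + \<phi> v u"
    by (simp only: bilinear_ladd[OF assms(1)] bilinear_radd[OF assms(1)]) (simp add: assms(2))
  then show ?thesis
    using assms(2)[of "u + v"] by linarith
qed

lemma alternating_form_lift:
  fixes \<phi> :: "'v::real_vector \<Rightarrow> 'v \<Rightarrow> real"
  assumes "bilinear \<phi>" "\<And>v. \<phi> v v = 0"
  obtains L where "linear L" "\<And>u v. L (wedge u v) = \<phi> u v"
proof -
  \<comment> \<open>The linearity clauses compare words of equal length, so extending by 0 to all
    lengths other than 2 is consistent.\<close>
  have "alternating_on_lists (\<lambda>vs. case vs of [a, b] \<Rightarrow> \<phi> a b | _ \<Rightarrow> 0)"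
    unfolding alternating_on_lists_def
    by (auto simp: bilinear_ladd[OF assms(1)] bilinear_radd[OF assms(1)] bilinear_lmul[OF assms(1)]
        bilinear_rmul[OF assms(1)] assms(2) append_eq_Cons_conv split: list.splits)
  then obtain L where L: "linear L"
      "\<And>vs. L (prod_list (map ext_vec vs)) = (case vs of [a, b] \<Rightarrow> \<phi> a b | _ \<Rightarrow> 0)"
    using exterior_lift_ex by blast
  have "L (wedge u v) = \<phi> u v" for u v
    using L(2)[of "[u, v]"] by (simp add: wedge_def)
  with L(1) that show ?thesis by blast
qed

lemma wedge_form_lift:
  fixes \<omega> :: "'v::real_vector \<Rightarrow> 'v \<Rightarrow> real"
  assumes "bilinear \<omega>" "\<And>v. \<omega> v v = 0"
  obtains L where "linear L"
    "\<And>a b c d. L (ext_vec a * ext_vec b * ext_vec c * ext_vec d) = wedge_form \<omega> \<omega> a b c d"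
proof -
  note anti = alternating_imp_antisym[OF assms]
  define \<psi> where "\<psi> vs = (case vs of [a, b, c, d] \<Rightarrow> wedge_form \<omega> \<omega> a b c d | _ \<Rightarrow> 0)" for vs
  have \<psi>0: "\<psi> vs = 0" if "length vs \<noteq> 4" for vs
    using that by (auto simp: \<psi>_def split: list.splits)
  \<comment> \<open>The varied entry may stand in any of four slots; the other three entries are
    split between \<open>xs\<close> and \<open>ys\<close> accordingly. For a repeated entry,
    \<open>slot_cases2\<close> splits the remaining two.\<close>
  have slot_cases: "(xs = [] \<and> (\<exists>a b c. ys = [a, b, c])) \<or> (\<exists>a. xs = [a] \<and> (\<exists>b c. ys = [b, c])) \<or>
      (\<exists>a b. xs = [a, b] \<and> (\<exists>c. ys = [c])) \<or> (\<exists>a b c. xs = [a, b, c] \<and> ys = [])"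
    if "length xs + length ys = 3" for xs ys :: "'v list"
  proof -
    have "length xs = 0 \<and> length ys = 3 \<or> length xs = 1 \<and> length ys = 2
      \<or> length xs = 2 \<and> length ys = 1 \<or> length xs = 3 \<and> length ys = 0"
      using that by presburger
    then show ?thesis
      by (elim disjE) (auto simp: eval_nat_numeral length_Suc_conv)
  qed
  have slot_cases2: "(xs = [] \<and> (\<exists>a b. ys = [a, b])) \<or> (\<exists>a. xs = [a] \<and> (\<exists>b. ys = [b])) \<or>
      (\<exists>a b. xs = [a, b] \<and> ys = [])"
    if "length xs + length ys = 2" for xs ys :: "'v list"
  proof -
    have "length xs = 0 \<and> length ys = 2 \<or> length xs = 1 \<and> length ys = 1
      \<or> length xs = 2 \<and> length ys = 0"
      using that by presburger
    then show ?thesis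
      by (elim disjE) (auto simp: eval_nat_numeral length_Suc_conv)
  qed
  have "\<psi> (xs @ (u + v) # ys) = \<psi> (xs @ u # ys) + \<psi> (xs @ v # ys)" for xs ys u v
  proof (cases "length xs + length ys = 3")
    case True
    from slot_cases[OF this] show ?thesis
      by (elim disjE exE conjE) (simp_all add: \<psi>_def wedge_form_def bilinear_ladd[OF assms(1)]
          bilinear_radd[OF assms(1)] algebra_simps)
  qed (simp add: \<psi>0)
  moreover have "\<psi> (xs @ (c *\<^sub>R v) # ys) = c * \<psi> (xs @ v # ys)" for xs ys c v
  proof (cases "length xs + length ys = 3")
    case True
    from slot_cases[OF this] show ?thesis
      by (elim disjE exE conjE) (simp_all add: \<psi>_def wedge_form_def bilinear_lmul[OF assms(1)]
          bilinear_rmul[OF assms(1)] algebra_simps)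
  qed (simp add: \<psi>0)
  moreover have "\<psi> (xs @ v # v # ys) = 0" for xs ys v
  proof (cases "length xs + length ys = 2")
    case True
    from slot_cases2[OF this] show ?thesis
      by (elim disjE exE conjE)
        (auto simp: \<psi>_def wedge_form_def assms(2) anti[of _ v])
  qed (simp add: \<psi>0)
  ultimately have "alternating_on_lists \<psi>"
    unfolding alternating_on_lists_def by blast
  then obtain L where L: "linear L" "\<And>vs. L (prod_list (map ext_vec vs)) = \<psi> vs"
    using exterior_lift_ex by blast
  have "L (ext_vec a * ext_vec b * ext_vec c * ext_vec d) = wedge_form \<omega> \<omega> a b c d" for a b c d
    using L(2)[of "[a, b, c, d]"] by (simp add: \<psi>_def mult.assoc)
  with L(1) that show ?thesis by blast
qed


section \<open>Decomposable bivectors and the Pluecker line of a plane\<close>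

lemma in_span_pair_iff:
  fixes u v :: "'v::real_vector"
  shows "x \<in> span {u, v} \<longleftrightarrow> (\<exists>s t. x = s *\<^sub>R u + t *\<^sub>R v)"
  by (simp add: span_breakdown_eq algebra_simps)

text \<open>The factor is the determinant of the coefficients of \<open>x\<close> and
  \<open>y\<close>.\<close>

lemma wedge_in_span_wedge:
  assumes "x \<in> span {u, v}" "y \<in> span {u, v}"
  shows "wedge x y \<in> span {wedge u v}"
proof -
  obtain a b c d where "x = a *\<^sub>R u + b *\<^sub>R v" "y = c *\<^sub>R u + d *\<^sub>R v"
    using assms by (auto simp: in_span_pair_iff)
  then have "wedge x y = (a * d - b * c) *\<^sub>R wedge u v"
    by (simp add: wedge_def ext_vec_add ext_vec_scaleR algebra_simps ext_vec_square
        ext_vec_anticomm[of v u])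
  then show ?thesis
    by (simp add: span_scale span_base)
qed

text \<open>Any two bases of the plane have wedges that are multiples of each other, so the line
  does not depend on the basis.\<close>

lemma pluecker_span:
  assumes "independent {u, v}" "u \<noteq> v"
  shows "pluecker (span {u, v}) = span {wedge u v}"
  unfolding pluecker_def
proof (rule the_equality)
  fix l
  assume "\<exists>x y. x \<noteq> y \<and> independent {x, y} \<and> span {u, v} = span {x, y} \<and> l = span {wedge x y}"
  then obtain x y where xy: "span {u, v} = span {x, y}" "l = span {wedge x y}"
    by blast
  have "{x, y} \<subseteq> span {x, y}" "{u, v} \<subseteq> span {u, v}"
    by (auto simp: span_base)
  then have "x \<in> span {u, v}" "y \<in> span {u, v}" "u \<in> span {x, y}" "v \<in> span {x, y}"
    using xy(1) by blast+
  then have "wedge x y \<in> span {wedge u v}" "wedge u v \<in> span {wedge x y}"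
    by (simp_all add: wedge_in_span_wedge)
  then show "l = span {wedge u v}"
    by (simp add: xy(2) span_eq)
qed (use assms in blast)

lemma span_singleton_scaleR:
  fixes x :: "'v::real_vector"
  assumes "c \<noteq> 0"
  shows "span {c *\<^sub>R x} = span {x}"
proof -
  have "x = (1 / c) *\<^sub>R (c *\<^sub>R x)"
    using assms by simp
  then have "x \<in> span {c *\<^sub>R x}"
    by (metis span_base span_scale singletonI)
  then show ?thesis
    by (simp add: span_eq span_scale span_base)
qed


section \<open>Bivectors in a symplectic basis\<close>

text \<open>Two mutually orthogonal hyperbolic pairs. Their linear independence follows from
  \<open>pairs\<close>.\<close>

locale symplectic_basis =
  fixes \<omega> :: "'v::real_vector \<Rightarrow> 'v \<Rightarrow> real" and e\<^sub>1 e\<^sub>2 e\<^sub>3 e\<^sub>4 :: 'v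
  assumes symplectic: "symplectic_form \<omega>"
    and pairs: "\<omega> e\<^sub>1 e\<^sub>2 = 1" "\<omega> e\<^sub>3 e\<^sub>4 = 1" "\<omega> e\<^sub>1 e\<^sub>3 = 0" "\<omega> e\<^sub>1 e\<^sub>4 = 0" "\<omega> e\<^sub>2 e\<^sub>3 = 0" "\<omega> e\<^sub>2 e\<^sub>4 = 0"
    and spanning: "\<And>x. \<exists>a b c d. x = a *\<^sub>R e\<^sub>1 + b *\<^sub>R e\<^sub>2 + c *\<^sub>R e\<^sub>3 + d *\<^sub>R e\<^sub>4"
begin

lemma bilinear: "bilinear \<omega>" and alternating: "\<omega> v v = 0"
  using symplectic by (auto simp: symplectic_form_def)

lemma antisym: "\<omega> u v = - \<omega> v u"
  by (rule alternating_imp_antisym[OF bilinear alternating])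

lemma omega_basis_values:
  "\<omega> e\<^sub>2 e\<^sub>1 = -1" "\<omega> e\<^sub>4 e\<^sub>3 = -1" "\<omega> e\<^sub>3 e\<^sub>1 = 0" "\<omega> e\<^sub>4 e\<^sub>1 = 0" "\<omega> e\<^sub>3 e\<^sub>2 = 0" "\<omega> e\<^sub>4 e\<^sub>2 = 0"
  using pairs antisym[of e\<^sub>2 e\<^sub>1] antisym[of e\<^sub>4 e\<^sub>3] antisym[of e\<^sub>3 e\<^sub>1] antisym[of e\<^sub>4 e\<^sub>1]
    antisym[of e\<^sub>3 e\<^sub>2] antisym[of e\<^sub>4 e\<^sub>2] by simp_all

definition vec :: "real \<Rightarrow> real \<Rightarrow> real \<Rightarrow> real \<Rightarrow> 'v" where
  "vec a b c d = a *\<^sub>R e\<^sub>1 + b *\<^sub>R e\<^sub>2 + c *\<^sub>R e\<^sub>3 + d *\<^sub>R e\<^sub>4"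

text \<open>Coordinates turn the later statements about bivectors into polynomial
  identities.\<close>

definition biv :: "real \<Rightarrow> real \<Rightarrow> real \<Rightarrow> real \<Rightarrow> real \<Rightarrow> real \<Rightarrow> 'v exterior" where
  "biv p q r s t w = p *\<^sub>R wedge e\<^sub>1 e\<^sub>2 + q *\<^sub>R wedge e\<^sub>1 e\<^sub>3 + r *\<^sub>R wedge e\<^sub>1 e\<^sub>4
     + s *\<^sub>R wedge e\<^sub>2 e\<^sub>3 + t *\<^sub>R wedge e\<^sub>2 e\<^sub>4 + w *\<^sub>R wedge e\<^sub>3 e\<^sub>4"

lemma vec_cases: obtains a b c d where "x = vec a b c d"
  using spanning[of x] unfolding vec_def by blast

lemma omega_vec: "\<omega> (vec a b c d) (vec a' b' c' d') = a * b' - b * a' + c * d' - d * c'"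
  by (simp add: vec_def bilinear_ladd[OF bilinear] bilinear_radd[OF bilinear]
      bilinear_lmul[OF bilinear] bilinear_rmul[OF bilinear] pairs omega_basis_values alternating
      algebra_simps)

lemma omega_vec_basis: "\<omega> (vec a b c d) e\<^sub>1 = - b" "\<omega> (vec a b c d) e\<^sub>2 = a"
  by (simp_all add: vec_def bilinear_ladd[OF bilinear] bilinear_lmul[OF bilinear] pairs
      omega_basis_values alternating)

lemma biv_add: "biv p q r s t w + biv p' q' r' s' t' w' = biv (p+p') (q+q') (r+r') (s+s') (t+t') (w+w')"
  by (simp add: biv_def algebra_simps)

lemma biv_scaleR: "c *\<^sub>R biv p q r s t w = biv (c*p) (c*q) (c*r) (c * s) (c*t) (c*w)"
  by (simp add: biv_def algebra_simps)

text \<open>The coordinates are the 2x2 minors of the coefficient matrix, that is, the Pluecker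
  coordinates.\<close>

lemma wedge_vec:
  "wedge (vec a b c d) (vec a' b' c' d') =
     biv (a*b' - b*a') (a*c' - c*a') (a*d' - d*a') (b*c' - c*b') (b*d' - d*b') (c*d' - d*c')"
  by (simp add: vec_def biv_def wedge_def ext_vec_add ext_vec_scaleR algebra_simps ext_vec_square
      ext_vec_anticomm[of e\<^sub>2 e\<^sub>1] ext_vec_anticomm[of e\<^sub>3 e\<^sub>1] ext_vec_anticomm[of e\<^sub>4 e\<^sub>1]
      ext_vec_anticomm[of e\<^sub>3 e\<^sub>2] ext_vec_anticomm[of e\<^sub>4 e\<^sub>2] ext_vec_anticomm[of e\<^sub>4 e\<^sub>3])

text \<open>Grouping by the smaller index writes a bivector as three decomposable ones, which places
  it in \<open>ext_power 2\<close>.\<close>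

lemma biv_eq_lincomb_wedge: "biv p q r s t w =
    wedge (vec 1 0 0 0) (vec 0 p q r) + wedge (vec 0 1 0 0) (vec 0 0 s t)
      + wedge (vec 0 0 1 0) (vec 0 0 0 w)"
  by (simp add: wedge_vec biv_add)

lemma ext_power2_eq: "ext_power 2 = {biv p q r s t w | p q r s t w. True}" (is "_ = ?B")
proof
  have "subspace ?B"
    unfolding subspace_def
  proof (intro conjI ballI allI)
    show "0 \<in> ?B"
      by (clarsimp, intro exI[of _ 0]) (simp add: biv_def)
  next
    fix x y assume "x \<in> ?B" "y \<in> ?B"
    then show "x + y \<in> ?B"
      using biv_add by blast
  next
    fix c x assume "x \<in> ?B"
    then show "c *\<^sub>R x \<in> ?B"
      using biv_scaleR by blast
  qed
  moreover have "wedge x y \<in> ?B" for x y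
    by (rule vec_cases[of x], rule vec_cases[of y]) (use wedge_vec in blast)
  ultimately show "ext_power 2 \<subseteq> ?B"
    unfolding ext_power_def
    by (intro span_minimal) (auto simp: numeral_2_eq_2 length_Suc_conv simp flip: wedge_def)
  have "wedge x y \<in> ext_power 2" for x y
    unfolding ext_power_def
    by (rule span_base) (auto simp: wedge_def intro!: exI[of _ "[x, y]"])
  then show "?B \<subseteq> ext_power 2"
    by (auto simp: biv_eq_lincomb_wedge ext_power_def intro!: span_add)
qed

lemma biv_in_ext_power2: "biv p q r s t w \<in> ext_power 2"
  unfolding ext_power2_eq by blast

section \<open>The fourth exterior power, \<open>vol\<close> and the dot product\<close>

abbreviation E :: "'v exterior" where
  "E \<equiv> ext_vec e\<^sub>1 * ext_vec e\<^sub>2 * ext_vec e\<^sub>3 * ext_vec e\<^sub>4"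

lemma basis_products:
  "wedge e\<^sub>1 e\<^sub>2 * wedge e\<^sub>3 e\<^sub>4 = E" "wedge e\<^sub>3 e\<^sub>4 * wedge e\<^sub>1 e\<^sub>2 = E"
  "wedge e\<^sub>1 e\<^sub>3 * wedge e\<^sub>2 e\<^sub>4 = - E" "wedge e\<^sub>2 e\<^sub>4 * wedge e\<^sub>1 e\<^sub>3 = - E"
  "wedge e\<^sub>1 e\<^sub>4 * wedge e\<^sub>2 e\<^sub>3 = E" "wedge e\<^sub>2 e\<^sub>3 * wedge e\<^sub>1 e\<^sub>4 = E"
proof -
  \<comment> \<open>These rules sort indices increasingly, the second one inside right-nested
    products. Only decreasing pairs are instantiated, so rewriting stops.\<close>
  have s: "ext_vec y * ext_vec x = - (ext_vec x * ext_vec y)"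
      "ext_vec y * (ext_vec x * z) = - (ext_vec x * (ext_vec y * z))" for x y :: 'v and z
    using ext_vec_anticomm[of y x] by (simp_all flip: mult.assoc)
  note [simp] = s[where y = e\<^sub>2 and x = e\<^sub>1] s[where y = e\<^sub>3 and x = e\<^sub>1] s[where y = e\<^sub>4 and x = e\<^sub>1]
    s[where y = e\<^sub>3 and x = e\<^sub>2] s[where y = e\<^sub>4 and x = e\<^sub>2] s[where y = e\<^sub>4 and x = e\<^sub>3]
  show "wedge e\<^sub>1 e\<^sub>2 * wedge e\<^sub>3 e\<^sub>4 = E" "wedge e\<^sub>3 e\<^sub>4 * wedge e\<^sub>1 e\<^sub>2 = E"
    "wedge e\<^sub>1 e\<^sub>3 * wedge e\<^sub>2 e\<^sub>4 = - E" "wedge e\<^sub>2 e\<^sub>4 * wedge e\<^sub>1 e\<^sub>3 = - E"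
    "wedge e\<^sub>1 e\<^sub>4 * wedge e\<^sub>2 e\<^sub>3 = E" "wedge e\<^sub>2 e\<^sub>3 * wedge e\<^sub>1 e\<^sub>4 = E"
    by (simp_all add: wedge_def mult.assoc)
qed

text \<open>Of the 36 products of basis wedges, only the six ordered pairs with complementary
  indices survive \<open>wedge_mult_common\<close>.\<close>

lemma biv_mult:
  "biv p q r s t w * biv p' q' r' s' t' w' =
     (p*w' - q*t' + r * s' + s*r' - t*q' + w*p') *\<^sub>R E"
  by (simp add: biv_def distrib_left distrib_right basis_products wedge_mult_common)
    (simp add: algebra_simps)

lemma ext_power4_eq: "ext_power 4 = span {E}"
proof
  have "ext_vec a * ext_vec b * ext_vec c * ext_vec d \<in> span {E}" for a b c d
  proof -
    have "ext_vec a * ext_vec b * ext_vec c * ext_vec d = wedge a b * wedge c d"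
      by (simp add: wedge_def mult.assoc)
    moreover obtain p q r s t w where "wedge a b = biv p q r s t w"
      using wedge_vec by (metis vec_cases)
    moreover obtain p' q' r' s' t' w' where "wedge c d = biv p' q' r' s' t' w'"
      using wedge_vec by (metis vec_cases)
    ultimately show ?thesis
      by (simp only: biv_mult) (simp add: span_scale span_base)
  qed
  then show "ext_power 4 \<subseteq> span {E}"
    unfolding ext_power_def
    by (intro span_minimal) (auto simp: eval_nat_numeral length_Suc_conv simp flip: mult.assoc)
  have "E \<in> ext_power 4"
    unfolding ext_power_def
    by (rule span_base) (auto simp: mult.assoc intro!: exI[of _ "[e\<^sub>1, e\<^sub>2, e\<^sub>3, e\<^sub>4]"])
  then show "span {E} \<subseteq> ext_power 4"
    unfolding ext_power_def by (intro span_minimal) auto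
qed

text \<open>In \<open>wedge_form\<close> only the first and the last shuffle are nonzero on the
  basis, and each gives 1.\<close>

lemma functional4_E: "functional4 (wedge_form \<omega> \<omega>) (c *\<^sub>R E) = 2 * c"
proof -
  obtain L where L: "linear L"
    "\<And>a b c d. L (ext_vec a * ext_vec b * ext_vec c * ext_vec d) = wedge_form \<omega> \<omega> a b c d"
    using wedge_form_lift[OF bilinear alternating] by blast
  have "functional4 (wedge_form \<omega> \<omega>) (c *\<^sub>R E) = L (c *\<^sub>R E)"
    by (rule functional4_eqI[OF L]) (simp add: ext_power4_eq span_scale span_base)
  then show ?thesis
    by (simp add: linear_scale[OF L(1)] L(2) wedge_form_def pairs)
qed

text \<open>The functional separates \<open>E\<close> from 0; this is what allows coefficients of
  \<open>E\<close> to be compared.\<close>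

lemma E_nonzero: "E \<noteq> 0"
  using functional4_E[of 1] functional4_E[of 0] by auto

text \<open>\<open>ext_power 4\<close> is the line through \<open>E\<close>, and the functional is 2
  on \<open>E\<close>, so the value -2 singles out \<open>- E\<close>.\<close>

lemma vol_eq: "vol \<omega> = - E"
  unfolding vol_def
proof (rule the_equality)
  show "- E \<in> ext_power 4 \<and> functional4 (wedge_form \<omega> \<omega>) (- E) = - 2"
    using functional4_E[of "-1"] by (simp add: ext_power4_eq span_neg span_base)
next
  fix \<tau> assume \<tau>: "\<tau> \<in> ext_power 4 \<and> functional4 (wedge_form \<omega> \<omega>) \<tau> = - 2"
  then obtain c where "\<tau> = c *\<^sub>R E"
    by (auto simp: ext_power4_eq span_singleton)
  with \<tau> functional4_E[of c] show "\<tau> = - E" by simp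
qed

lemma bivec_dot_biv:
  "bivec_dot \<omega> (biv p q r s t w) (biv p' q' r' s' t' w') =
     - (p*w' - q*t' + r * s' + s*r' - t*q' + w*p')"
  unfolding bivec_dot_def
proof (rule the_equality)
  fix c assume "biv p q r s t w * biv p' q' r' s' t' w' = c *\<^sub>R vol \<omega>"
  then have "(p*w' - q*t' + r * s' + s*r' - t*q' + w*p') *\<^sub>R E = (- c) *\<^sub>R E"
    by (simp only: biv_mult vol_eq) simp
  then have "p*w' - q*t' + r * s' + s*r' - t*q' + w*p' = - c"
    using E_nonzero scaleR_right_imp_eq by blast
  then show "c = - (p*w' - q*t' + r * s' + s*r' - t*q' + w*p')"
    by simp
qed (simp only: biv_mult vol_eq scaleR_minus_left scaleR_minus_right minus_minus)

lemma omega_star_eq: "omega_star \<omega> = biv (-1) 0 0 0 0 (-1)"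
  unfolding omega_star_def
proof (rule the_equality)
  have "bivec_dot \<omega> (biv (-1) 0 0 0 0 (-1)) (wedge u v) = \<omega> u v" for u v
    by (rule vec_cases[of u], rule vec_cases[of v])
      (simp add: wedge_vec bivec_dot_biv omega_vec algebra_simps)
  then show "biv (-1) 0 0 0 0 (-1) \<in> ext_power 2 \<and>
      (\<forall>u v. bivec_dot \<omega> (biv (-1) 0 0 0 0 (-1)) (wedge u v) = \<omega> u v)"
    by (simp add: biv_in_ext_power2)
next
  fix \<alpha> assume \<alpha>: "\<alpha> \<in> ext_power 2 \<and> (\<forall>u v. bivec_dot \<omega> \<alpha> (wedge u v) = \<omega> u v)"
  then obtain p q r s t w where a: "\<alpha> = biv p q r s t w"
    by (auto simp: ext_power2_eq)
  have dot: "bivec_dot \<omega> \<alpha> (wedge (vec a b c d) (vec a' b' c' d')) = \<omega> (vec a b c d) (vec a' b' c' d')"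
    for a b c d a' b' c' d'
    using \<alpha> by blast
  \<comment> \<open>Pairing with the six basis wedges isolates, up to sign, the coordinate of
    \<open>\<alpha>\<close> at the complementary index pair.\<close>
  note eqs = dot[of 1 0 0 0 0 1 0 0] dot[of 1 0 0 0 0 0 1 0] dot[of 1 0 0 0 0 0 0 1]
    dot[of 0 1 0 0 0 0 1 0] dot[of 0 1 0 0 0 0 0 1] dot[of 0 0 1 0 0 0 0 1]
  have "p = -1" "q = 0" "r = 0" "s = 0" "t = 0" "w = -1"
    by (insert eqs[unfolded a wedge_vec bivec_dot_biv omega_vec, simplified]) linarith+
  then show "\<alpha> = biv (-1) 0 0 0 0 (-1)"
    by (simp add: a)
qed

section \<open>The maps \<open>mu\<close> and \<open>eta\<close> in coordinates\<close>

lemma functional2_biv: "functional2 \<omega> (biv p q r s t w) = p + w"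
proof -
  obtain L where L: "linear L" "\<And>u v. L (wedge u v) = \<omega> u v"
    using alternating_form_lift[OF bilinear alternating] by blast
  have "functional2 \<omega> (biv p q r s t w) = L (biv p q r s t w)"
    by (rule functional2_eqI[OF L biv_in_ext_power2])
  then show ?thesis
    by (simp add: biv_def linear_add[OF L(1)] linear_scale[OF L(1)] L(2) pairs)
qed

text \<open>On bivectors this is the orthogonal projection along \<open>omega_star \<omega>\<close>;
  the square of \<open>omega_star \<omega>\<close> being -2 explains the coefficient 1/2 and its
  sign.\<close>

definition mu_vec :: "'v exterior \<Rightarrow> 'v exterior" where
  "mu_vec \<sigma> = \<sigma> + (1 / 2 * functional2 \<omega> \<sigma>) *\<^sub>R omega_star \<omega>"

text \<open>The first and last coordinates become opposite, so by \<open>functional2_biv\<close> the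
  image lies in the kernel of \<open>\<omega>\<close>.\<close>

lemma mu_vec_biv: "mu_vec (biv p q r s t w) = biv ((p - w) / 2) q r s t ((w - p) / 2)"
  by (simp add: mu_vec_def functional2_biv omega_star_eq biv_scaleR biv_add field_simps)

text \<open>Homogeneity makes the map well defined on lines; \<open>functional2\<close> is
  meaningful on \<open>ext_power 2\<close>, hence the hypothesis.\<close>

lemma mu_vec_scaleR:
  assumes "\<sigma> \<in> ext_power 2"
  shows "mu_vec (c *\<^sub>R \<sigma>) = c *\<^sub>R mu_vec \<sigma>"
  using assms by (auto simp: ext_power2_eq biv_scaleR mu_vec_biv algebra_simps)

lemma wedge_in_ext_power2: "wedge (u :: 'v) v \<in> ext_power 2"
  by (rule vec_cases[of u], rule vec_cases[of v]) (simp add: wedge_vec biv_in_ext_power2)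

lemma functional2_wedge: "functional2 \<omega> (wedge u v) = \<omega> u v"
  by (rule vec_cases[of u], rule vec_cases[of v]) (simp add: wedge_vec functional2_biv omega_vec)

lemma bivec_dot_scaleR:
  assumes "\<alpha> \<in> ext_power 2" "\<beta> \<in> ext_power 2"
  shows "bivec_dot \<omega> (c *\<^sub>R \<alpha>) (d *\<^sub>R \<beta>) = c * d * bivec_dot \<omega> \<alpha> \<beta>"
  using assms by (auto simp: ext_power2_eq biv_scaleR bivec_dot_biv algebra_simps)

lemma mu_span:
  assumes "\<omega> u v \<noteq> 0"
  shows "mu \<omega> (span {u, v}) = span {mu_vec (wedge u v)}"
proof -
  have "u \<notin> span {v}"
    using assms by (auto simp: span_singleton bilinear_lmul[OF bilinear] alternating)
  moreover have "v \<noteq> 0"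
    using assms by (auto simp: bilinear_rzero[OF bilinear])
  ultimately have "independent {u, v}" "u \<noteq> v"
    by (auto simp: independent_insert span_base)
  then have pl: "pluecker (span {u, v}) = span {wedge u v}"
    by (rule pluecker_span)
  \<comment> \<open>As a functional on bivectors, \<open>\<omega>\<close> takes the nonzero value
    \<open>\<omega> u v\<close> on this wedge.\<close>
  have nz: "wedge u v \<noteq> 0"
    using assms functional2_wedge[of u v] functional2_biv[of 0 0 0 0 0 0] by (auto simp: biv_def)
  show ?thesis
    unfolding mu_def
  proof (rule the_equality)
    show "\<exists>\<sigma>. \<sigma> \<in> pluecker (span {u, v}) \<and> \<sigma> \<noteq> 0 \<and> span {mu_vec (wedge u v)} =
        span {\<sigma> + (1 / 2 * functional2 \<omega> \<sigma>) *\<^sub>R omega_star \<omega>}"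
      using nz by (intro exI[of _ "wedge u v"]) (simp add: pl span_base mu_vec_def)
  next
    fix l
    assume "\<exists>\<sigma>. \<sigma> \<in> pluecker (span {u, v}) \<and> \<sigma> \<noteq> 0 \<and>
        l = span {\<sigma> + (1 / 2 * functional2 \<omega> \<sigma>) *\<^sub>R omega_star \<omega>}"
    then obtain c where "c \<noteq> 0" "l = span {mu_vec (c *\<^sub>R wedge u v)}"
      by (auto simp: pl span_singleton mu_vec_def)
    then show "l = span {mu_vec (wedge u v)}"
      by (simp add: mu_vec_scaleR wedge_in_ext_power2 span_singleton_scaleR)
  qed
qed

text \<open>Unit vectors on a spacelike line are unique up to sign, and the absolute value removes
  the sign.\<close>

lemma eta_span:
  assumes \<alpha>: "\<alpha> \<in> ext_power 2" "bivec_dot \<omega> \<alpha> \<alpha> > 0"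
    and \<beta>: "\<beta> \<in> ext_power 2" "bivec_dot \<omega> \<beta> \<beta> > 0"
  shows "eta \<omega> (span {\<alpha>}) (span {\<beta>}) =
    \<bar>bivec_dot \<omega> \<alpha> \<beta>\<bar> / sqrt (bivec_dot \<omega> \<alpha> \<alpha> * bivec_dot \<omega> \<beta> \<beta>)"
  unfolding eta_def
proof (rule the_equality)
  let ?a = "bivec_dot \<omega> \<alpha> \<alpha>" and ?b = "bivec_dot \<omega> \<beta> \<beta>"
  show "\<exists>s\<^sub>1 s\<^sub>2. s\<^sub>1 \<in> span {\<alpha>} \<and> s\<^sub>2 \<in> span {\<beta>} \<and> bivec_dot \<omega> s\<^sub>1 s\<^sub>1 = 1 \<and> bivec_dot \<omega> s\<^sub>2 s\<^sub>2 = 1 \<and>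
      \<bar>bivec_dot \<omega> \<alpha> \<beta>\<bar> / sqrt (?a * ?b) = \<bar>bivec_dot \<omega> s\<^sub>1 s\<^sub>2\<bar>"
    using assms
    by (intro exI[of _ "(1 / sqrt ?a) *\<^sub>R \<alpha>"] exI[of _ "(1 / sqrt ?b) *\<^sub>R \<beta>"])
      (simp add: bivec_dot_scaleR span_scale span_base abs_mult real_sqrt_mult)
  fix r
  assume "\<exists>s\<^sub>1 s\<^sub>2. s\<^sub>1 \<in> span {\<alpha>} \<and> s\<^sub>2 \<in> span {\<beta>} \<and> bivec_dot \<omega> s\<^sub>1 s\<^sub>1 = 1 \<and> bivec_dot \<omega> s\<^sub>2 s\<^sub>2 = 1 \<and>
      r = \<bar>bivec_dot \<omega> s\<^sub>1 s\<^sub>2\<bar>"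
  then obtain c d where cd: "c * c * ?a = 1" "d * d * ?b = 1" "r = \<bar>c * d * bivec_dot \<omega> \<alpha> \<beta>\<bar>"
    using \<alpha>(1) \<beta>(1) by (auto simp: span_singleton bivec_dot_scaleR)
  \<comment> \<open>Multiplying the two normalisations determines \<open>\<bar>c * d\<bar>\<close>,
    although \<open>c\<close> and \<open>d\<close> are known only up to sign.\<close>
  have "(c * d)\<^sup>2 * (?a * ?b) = (c * c * ?a) * (d * d * ?b)"
    by (simp add: power2_eq_square)
  then have "sqrt ((c * d)\<^sup>2 * (?a * ?b)) = 1"
    by (simp only: cd) simp
  then have "\<bar>c * d\<bar> * sqrt (?a * ?b) = 1"
    by (simp add: real_sqrt_mult)
  then have "\<bar>c * d\<bar> = 1 / sqrt (?a * ?b)"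
    using assms by (simp add: field_simps)
  with cd(3) show "r = \<bar>bivec_dot \<omega> \<alpha> \<beta>\<bar> / sqrt (?a * ?b)"
    by (simp add: abs_mult)
qed

text \<open>The rows (a b) and (c d) are the images of the first two basis vectors, so the plane is the
  graph of a map with determinant \<open>a * d - b * c\<close>.\<close>

lemma eta_mu_graph:
  assumes "a * d - b * c \<noteq> -1"
  shows "eta \<omega> (mu \<omega> (span {e\<^sub>1, e\<^sub>2})) (mu \<omega> (span {vec 1 0 a b, vec 0 1 c d})) =
    \<bar>1 - (a * d - b * c)\<bar> / \<bar>1 + (a * d - b * c)\<bar>"
proof -
  \<comment> \<open>The Pluecker coordinates are 1, 0, 0, 0, 0, 0 for the first plane and 1, c, d,
    -a, -b, D for the graph; \<open>\<alpha>\<close> and \<open>\<beta>\<close> are their images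
    under \<open>mu_vec\<close>.\<close>
  define D where "D = a * d - b * c"
  define \<alpha> where "\<alpha> = biv (1 / 2) 0 0 0 0 (- 1 / 2)"
  define \<beta> where "\<beta> = biv ((1 - D) / 2) c d (- a) (- b) ((D - 1) / 2)"
  have D: "1 + D \<noteq> 0"
    using assms by (simp add: D_def add_eq_0_iff)
  have "\<omega> (vec 1 0 a b) (vec 0 1 c d) \<noteq> 0"
    using D by (simp add: omega_vec D_def)
  then have "mu \<omega> (span {vec 1 0 a b, vec 0 1 c d}) = span {\<beta>}"
    by (simp add: mu_span wedge_vec mu_vec_biv \<beta>_def D_def)
  moreover have "mu \<omega> (span {e\<^sub>1, e\<^sub>2}) = span {\<alpha>}"
  proof -
    have "wedge e\<^sub>1 e\<^sub>2 = biv 1 0 0 0 0 0"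
      by (simp add: biv_def)
    then show ?thesis
      by (simp add: mu_span pairs mu_vec_biv \<alpha>_def)
  qed
  moreover have "eta \<omega> (span {\<alpha>}) (span {\<beta>}) = \<bar>1 - D\<bar> / \<bar>1 + D\<bar>"
  proof -
    have dots: "bivec_dot \<omega> \<alpha> \<alpha> = 1 / 2" "bivec_dot \<omega> \<alpha> \<beta> = (1 - D) / 2"
      by (simp_all add: \<alpha>_def \<beta>_def bivec_dot_biv field_simps)
    \<comment> \<open>The four middle coordinates contribute 2 D, which turns (1 - D)^2/2 into (1 +
      D)^2/2.\<close>
    have dot_\<beta>: "bivec_dot \<omega> \<beta> \<beta> = (1 + D)\<^sup>2 / 2"
      unfolding \<beta>_def bivec_dot_biv by (simp add: D_def power2_eq_square field_simps)
    have "sqrt (1 / 2 * ((1 + D)\<^sup>2 / 2)) = \<bar>1 + D\<bar> / 2"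
      by (simp add: real_sqrt_divide)
    moreover have "\<alpha> \<in> ext_power 2" "\<beta> \<in> ext_power 2"
      by (simp_all add: \<alpha>_def \<beta>_def biv_in_ext_power2)
    ultimately show ?thesis
      using D eta_span[of \<alpha> \<beta>] by (simp only: dots dot_\<beta>) simp
  qed
  ultimately show ?thesis
    by (simp flip: D_def)
qed

end


section \<open>Symplectic bases adapted to a plane\<close>

text \<open>A vector outside the span would give an independent set larger than a basis. Positivity
  of \<open>card A\<close> makes the basis finite, since infinite sets have \<open>card\<close>
  0.\<close>

lemma independent_card_eq_dim_imp_spanning:
  fixes A :: "'v::real_vector set"
  assumes "independent A" "finite A" "card A = dim (UNIV :: 'v set)" "card A > 0"
  shows "span A = UNIV"
proof (rule ccontr)
  assume "span A \<noteq> UNIV"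
  then obtain x where x: "x \<notin> span A" by blast
  obtain B :: "'v set" where B: "UNIV \<subseteq> span B" "card B = dim (UNIV :: 'v set)"
    using basis_exists[of UNIV] by metis
  with assms have "finite B"
    by (metis card_gt_0_iff)
  moreover have "independent (insert x A)"
    using x assms(1) by (simp add: independent_insert)
  ultimately have "card (insert x A) \<le> card B"
    using B(1) independent_span_bound[of B "insert x A"] by blast
  moreover have "x \<notin> A" using x span_base by blast
  ultimately show False
    using assms(2,3) B(2) by simp
qed

text \<open>Allows independence to be read off from values of \<open>\<omega>\<close>.\<close>

lemma not_in_span_if_functional:
  fixes g :: "'v::real_vector \<Rightarrow> real"
  assumes "linear g" "\<And>y. y \<in> A \<Longrightarrow> g y = 0" "g x \<noteq> 0"
  shows "x \<notin> span A"
  using linear_eq_0_on_span[OF assms(1,2)] assms(3) by blast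

text \<open>Symplectic Gram-Schmidt: a hyperbolic pair is found in \<open>S\<close>, then another
  one orthogonal to \<open>S\<close>.\<close>

lemma adapted_symplectic_basis:
  fixes \<omega> :: "'v::real_vector \<Rightarrow> 'v \<Rightarrow> real"
  assumes dim: "dim (UNIV :: 'v set) = 4"
    and symp: "symplectic_form \<omega>"
    and nondeg: "nondegenerate_plane \<omega> S"
  obtains e\<^sub>1 e\<^sub>2 e\<^sub>3 e\<^sub>4 where "symplectic_basis \<omega> e\<^sub>1 e\<^sub>2 e\<^sub>3 e\<^sub>4" "S = span {e\<^sub>1, e\<^sub>2}"
proof -
  have bil: "bilinear \<omega>" and alt: "\<And>v. \<omega> v v = 0"
    and nd: "\<And>u. (\<And>v. \<omega> u v = 0) \<Longrightarrow> u = 0"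
    using symp by (auto simp: symplectic_form_def)
  note bilin = bilinear_ladd[OF bil] bilinear_radd[OF bil] bilinear_lmul[OF bil] bilinear_rmul[OF bil]
    bilinear_lsub[OF bil] bilinear_rsub[OF bil]
  note anti = alternating_imp_antisym[OF bil alt]
  have S: "subspace S" "dim S = 2" and S_nd: "\<And>a. a \<in> S \<Longrightarrow> (\<And>b. b \<in> S \<Longrightarrow> \<omega> a b = 0) \<Longrightarrow> a = 0"
    using nondeg by (auto simp: nondegenerate_plane_def plane_def)
  obtain u where u: "u \<in> S" "u \<noteq> 0"
  proof -
    have "S \<noteq> {0}" using S(2) basis_card_eq_dim[of "{}" "{0 :: 'v}"] independent_empty by auto
    with subspace_0[OF S(1)] that show ?thesis by blast
  qed
  then obtain v0 where v0: "v0 \<in> S" "\<omega> u v0 \<noteq> 0"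
    using S_nd by blast
  define v where "v = (1 / \<omega> u v0) *\<^sub>R v0"
  have v: "v \<in> S" "\<omega> u v = 1" "\<omega> v u = -1"
    using v0 subspace_scale[OF S(1)] anti[of v u] by (auto simp: v_def bilin)
  have uv: "independent {u, v}" "u \<noteq> v"
  proof -
    have "u \<notin> span {v}"
      by (rule not_in_span_if_functional[of "\<lambda>x. \<omega> x v"]) (use bil v alt in \<open>auto simp: bilinear_def\<close>)
    moreover have "v \<noteq> 0" using v(2) bilinear_rzero[OF bil] by auto
    ultimately show "independent {u, v}" "u \<noteq> v"
      by (auto simp: independent_insert span_base)
  qed
  have S_span: "S = span {u, v}"
  proof (rule ccontr)
    assume "S \<noteq> span {u, v}"
    moreover have "span {u, v} \<subseteq> S"
      using u v S(1) by (intro span_minimal) auto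
    ultimately obtain x where x: "x \<in> S" "x \<notin> span {u, v}" by blast
    obtain B where B: "S \<subseteq> span B" "card B = 2"
      using basis_exists[of S] S(2) by metis
    have "finite B" using B(2) by (metis card.infinite zero_neq_numeral)
    moreover have "independent (insert x {u, v})"
      using x uv independent_insert[of x "{u, v}"] span_base by metis
    moreover have "insert x {u, v} \<subseteq> span B" using x u v B(1) by blast
    ultimately have "card (insert x {u, v}) \<le> 2"
      using independent_span_bound B(2) by metis
    moreover have "x \<noteq> u" "x \<noteq> v" using x span_base by blast+
    ultimately show False using uv(2) by simp
  qed
  \<comment> \<open>The projection onto the symplectic complement of \<open>S\<close> along
    \<open>S\<close>.\<close>
  define proj where "proj x = x - \<omega> x v *\<^sub>R u + \<omega> x u *\<^sub>R v" for x
  have proj: "\<omega> (proj x) u = 0" "\<omega> (proj x) v = 0" for x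
    using v by (simp_all add: proj_def bilin alt)
  have "S \<noteq> UNIV" using S(2) dim by auto
  then obtain x where x: "x \<notin> S" by blast
  define w where "w = proj x"
  have "w \<noteq> 0"
  proof
    assume "w = 0"
    then have "x = \<omega> x v *\<^sub>R u - \<omega> x u *\<^sub>R v"
      by (simp add: w_def proj_def algebra_simps)
    with x show False
      using u v S(1) by (metis subspace_diff subspace_scale)
  qed
  then obtain y0 where y0: "\<omega> w y0 \<noteq> 0" using nd by blast
  \<comment> \<open>Since \<open>w\<close> is orthogonal to \<open>S\<close>, projecting does not
    change the pairing with \<open>w\<close>, and the scaling makes it 1.\<close>
  define z where "z = proj ((1 / \<omega> w y0) *\<^sub>R y0)"
  have w0: "\<omega> w u = 0" "\<omega> w v = 0" "\<omega> u w = 0" "\<omega> v w = 0"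
    using proj[of x] anti[of u w] anti[of v w] by (simp_all add: w_def)
  have z0: "\<omega> z u = 0" "\<omega> z v = 0" "\<omega> u z = 0" "\<omega> v z = 0"
    using proj anti[of u z] anti[of v z] by (simp_all add: z_def)
  have wz: "\<omega> w z = 1" "\<omega> z w = -1"
    using y0 w0 anti[of z w] by (simp_all add: z_def proj_def bilin)
  have lin: "linear (\<lambda>x. \<omega> x y)" for y
    using bil by (simp add: bilinear_def)
  \<comment> \<open>Pairing with its partner separates each vector from the later ones:
    \<open>u\<close> with \<open>v\<close>, \<open>v\<close> with \<open>u\<close>, \<open>w\<close>
    with \<open>z\<close>.\<close>
  have "u \<notin> span {v, w, z}"
    by (rule not_in_span_if_functional[OF lin[of v]]) (use v w0 z0 alt in auto)
  moreover have "v \<notin> span {w, z}"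
    by (rule not_in_span_if_functional[OF lin[of u]]) (use v w0 z0 alt in auto)
  moreover have "w \<notin> span {z}"
    by (rule not_in_span_if_functional[OF lin[of z]]) (use wz alt in auto)
  moreover have "z \<noteq> 0" using wz bilinear_rzero[OF bil] by auto
  ultimately have "independent {u, v, w, z}" and "card {u, v, w, z} = 4"
    by (auto simp: independent_insert span_base card_insert_if)
  with dim have "span {u, v, w, z} = UNIV"
    by (intro independent_card_eq_dim_imp_spanning) auto
  then have "\<exists>a b c d. x = a *\<^sub>R u + b *\<^sub>R v + c *\<^sub>R w + d *\<^sub>R z" for x
  proof -
    assume "span {u, v, w, z} = UNIV"
    then have "x \<in> span {u, v, w, z}" by simp
    then obtain a b c d where "x - a *\<^sub>R u - b *\<^sub>R v - c *\<^sub>R w = d *\<^sub>R z"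
      by (auto simp: span_breakdown_eq[of _ _ "insert _ _"] span_breakdown_eq[of _ _ "{}"])
    then show ?thesis by (intro exI[of _ a] exI[of _ b] exI[of _ c] exI[of _ d]) (simp add: algebra_simps)
  qed
  with symp v wz w0 z0 have "symplectic_basis \<omega> u v w z"
    by unfold_locales auto
  with S_span that show ?thesis by blast
qed

theorem proposition4:
  fixes \<omega> :: "'v::real_vector \<Rightarrow> 'v \<Rightarrow> real"
    and S T :: "'v set"
    and f :: "'v \<Rightarrow> 'v"
  assumes "dim (UNIV :: 'v set) = 4"
    and "symplectic_form \<omega>"
    and "nondegenerate_plane \<omega> S"
    and "linear_between S (symp_perp \<omega> S) f"
    and "symp_Det \<omega> S f \<noteq> -1"
    and "T = graph_plane S f"
  shows "eta \<omega> (mu \<omega> S) (mu \<omega> T) = \<bar>1 - symp_Det \<omega> S f\<bar> / \<bar>1 + symp_Det \<omega> S f\<bar>"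
proof -
  obtain e\<^sub>1 e\<^sub>2 e\<^sub>3 e\<^sub>4 where basis: "symplectic_basis \<omega> e\<^sub>1 e\<^sub>2 e\<^sub>3 e\<^sub>4" and S: "S = span {e\<^sub>1, e\<^sub>2}"
    using adapted_symplectic_basis[OF assms(1-3)] by blast
  interpret symplectic_basis \<omega> e\<^sub>1 e\<^sub>2 e\<^sub>3 e\<^sub>4 by (fact basis)
  have S_iff: "x \<in> S \<longleftrightarrow> (\<exists>s t. x = s *\<^sub>R e\<^sub>1 + t *\<^sub>R e\<^sub>2)" for x
    unfolding S by (rule in_span_pair_iff)
  have e_in: "e\<^sub>1 \<in> S" "e\<^sub>2 \<in> S"
    by (simp_all add: S span_base)
  have f_perp: "\<omega> (f x) e\<^sub>1 = 0" "\<omega> (f x) e\<^sub>2 = 0" if "x \<in> S" for x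
    using assms(4) that e_in by (auto simp: linear_between_def symp_perp_def)
  \<comment> \<open>The complement of \<open>S\<close> is spanned by the second hyperbolic pair, so
    \<open>f\<close> is given by a 2x2 matrix.\<close>
  have perp_form: "\<exists>c d. y = vec 0 0 c d" if "\<omega> y e\<^sub>1 = 0" "\<omega> y e\<^sub>2 = 0" for y
    using that by (cases y rule: vec_cases) (auto simp: omega_vec_basis)
  obtain a b where fe1: "f e\<^sub>1 = vec 0 0 a b"
    using perp_form f_perp e_in(1) by blast
  obtain c d where fe2: "f e\<^sub>2 = vec 0 0 c d"
    using perp_form f_perp e_in(2) by blast
  have f_lin: "f (s *\<^sub>R e\<^sub>1 + t *\<^sub>R e\<^sub>2) = vec 0 0 (s * a + t * c) (s * b + t * d)" for s t
  proof -
    have "s *\<^sub>R e\<^sub>1 \<in> S" "t *\<^sub>R e\<^sub>2 \<in> S"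
      using e_in by (simp_all add: S span_scale)
    with assms(4) e_in have "f (s *\<^sub>R e\<^sub>1 + t *\<^sub>R e\<^sub>2) = s *\<^sub>R f e\<^sub>1 + t *\<^sub>R f e\<^sub>2"
      by (simp add: linear_between_def)
    then show ?thesis
      by (simp add: fe1 fe2 vec_def algebra_simps)
  qed
  have pair_vec: "s *\<^sub>R e\<^sub>1 + t *\<^sub>R e\<^sub>2 = vec s t 0 0" for s t
    by (simp add: vec_def)
  have Det: "symp_Det \<omega> S f = a * d - b * c"
    unfolding symp_Det_def
  proof (rule the_equality)
    show "\<forall>x\<in>S. \<forall>y\<in>S. \<omega> (f x) (f y) = (a * d - b * c) * \<omega> x y"
      by (auto simp: S_iff f_lin) (simp add: pair_vec omega_vec algebra_simps)
  next
    \<comment> \<open>The pair \<open>e\<^sub>1\<close>, \<open>e\<^sub>2\<close> has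
      \<open>\<omega>\<close>-value 1, so it reads off \<open>k\<close>.\<close>
    fix k assume "\<forall>x\<in>S. \<forall>y\<in>S. \<omega> (f x) (f y) = k * \<omega> x y"
    then have "\<omega> (f e\<^sub>1) (f e\<^sub>2) = k * \<omega> e\<^sub>1 e\<^sub>2" using e_in by blast
    then show "k = a * d - b * c"
      by (simp add: fe1 fe2 omega_vec pairs)
  qed
  have "T = span {vec 1 0 a b, vec 0 1 c d}"
  proof -
    have graph: "s *\<^sub>R e\<^sub>1 + t *\<^sub>R e\<^sub>2 + f (s *\<^sub>R e\<^sub>1 + t *\<^sub>R e\<^sub>2) = s *\<^sub>R vec 1 0 a b + t *\<^sub>R vec 0 1 c d" for s t
      unfolding f_lin by (simp add: vec_def algebra_simps)
    show ?thesis
      unfolding assms(6) graph_plane_def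
      by (intro set_eqI) (simp add: in_span_pair_iff, metis graph S_iff)
  qed
  \<comment> \<open>The order \<open>a d b c\<close> is that of first occurrence in
    \<open>eta_mu_graph\<close>, so each matrix entry keeps its name.\<close>
  with assms(5) eta_mu_graph[of a d b c] show ?thesis
    by (simp add: Det flip: S)
qed

end
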